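(* Suppose there exist $0<\delta<\delta_H$, $T>0$ and a closed domain $$\mathfrak D=\mathfrak D(\delta):=\{u\in L^1(\mathbb R;\mathbb R^N)\cap BV(\mathbb R;\mathbb R^N)\ :\ \Upsilon(u)\le\delta\}$$ such that: (i) for all $\nu$ and for every piecewise constant initial datum $\overline u\in\mathfrak D$, the fractional step approximations $w_\nu$ with initial datum $\overline u$ (constructed as described in the context) satisfy, in $[0,T]$, $$w_\nu(t,\cdot)\in\mathfrak D_p(\delta+Gt)$$ with $G$ depending only on $A$ and $g$, and, for all integers $n\ge1$ with $n\tau_\nu\le T$, $$\big\|w_\nu(n\tau_\nu+,\cdot)-P_{n\tau_\nu,(n-1)\tau_\nu}[w_\nu((n-1)\tau_\nu+,\cdot)]\big\|_{L^1}\le O(1)\,\big(o(\tau_\nu)+\varepsilon_\nu\tau_\nu\big),$$ where $o(s)$ is a function depending only on $A,g,\delta,T$ with $o(s)/s\to0$ as $s\to0$, and $O(1)$ is a constant independent of $\nu$ and $n$; (ii) for all $\overline u\in\mathfrak D$ and $0\le t\le T$ there is a vanishing viscosity solution $P_{t,0}\overline u$ of the Cauchy problem $u_t+A(u)u_x=g(t,x,u)$, $u(0,\cdot)=\overline u$ (the one provided by the theory recalled in the context). Then for every $\overline u\in\mathfrak D$ one can choose a suitable piecewise constant approximation $\overline w_\nu\in\mathfrak D$ of $\overline u$ such that, denoting by $w_\nu$ the $\nu$-th fractional step approximation with initial datum $\overline w_\nu$, for a.e. $t\in[0,T]$ the sequence $w_\nu(t,\cdot)$ converges in $L^1(\mathbb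 R;\mathbb R^N)$ to $P_{t,0}\overline u$ as $\nu\to\infty$.
   Context: **System.** $\Omega\subseteq\mathbb R^N$ is a domain, $A:\Omega\to\mathbb R^{N\times N}$ is smooth and strictly hyperbolic: $A(u)$ has $N$ real distinct eigenvalues $\lambda_1(u)<\dots<\lambda_N(u)$, with right and left eigenvectors $r_k(u),l_k(u)$ normalized by $|r_k(u)|=1$, $\langle r_k(u),l_h(u)\rangle=\delta_{kh}$. Since only solutions of small total variation are considered, one works near a fixed state $u_0\in\Omega$ and assumes that there are constants $\widehat\lambda_0<\dots<\widehat\lambda_N$ with $\widehat\lambda_{k-1}<\lambda_k(u)<\widehat\lambda_k$ for all $u$ and $k$. **Assumption (G)** (standing). The source $g=g(t,x,u)\in\mathbb R^N$ is continuously differentiable in $u$, continuous in $t$ and Lipschitz continuous with respect to $x$ and $u$, uniformly in $t$; moreover there is $\alpha\in L^1(\mathbb R)$ with $|g_x(t,x,u)|\le\alpha(x)$ for all $t,u$. **Viscous solution operator.** $P_{t,h}[w]$ is the value at time $t\ge h$ of the vanishing viscosity solution with datum $w$ at time $h$, i.e. the limit in $L^1_{loc}$, as $\varepsilon\to0+$, of the solutions of $u^\varepsilon_t+A(u^\varepsilon)u^\varepsilon_x=g(t,x,u^\varepsilon)+\varepsilon u^\varepsilon_{xx}$, $u^\varepsilon(h,\cdot)=w$. The vanishing viscosity theory providing $P$ (Christoforou) also provides, on the data under consideration, a constant $L>0$ such that $\|P_{t_1,h}w_1-P_{t_2,h}w_2\|_{L^1}\le L(\|w_1-w_2\|_{L^1}+|t_2-t_1|)$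 for $t_1,t_2\in[h,T]$, and the semigroup property $P_{t_2,t_0}w=P_{t_2,t_1}[P_{t_1,t_0}w]$ for $0\le t_0\le t_1\le t_2\le T$. $S_{t,h}[w]$ denotes the analogous operator for the homogeneous system ($g\equiv0$). **Elementary curves.** Fix $k\in\{1,\dots,N\}$. The ODE $\dot u=v,\ \dot v=(A(u)-\sigma)v,\ \dot\sigma=0$ for traveling profiles of $u_t+A(u)u_x=u_{xx}$ has, near the equilibrium $(u_0,0,\lambda_k(u_0))$, an $(N+2)$-dimensional center manifold, written as $\{v=v_k\,\widetilde r_k(u,v_k,\sigma)\}$, where $v_k=\langle l_k(u_0),v\rangle$ and $\widetilde r_k$ is smooth with $\widetilde r_k(u_0,0,\sigma)=r_k(u_0)$ and $\langle l_k(u_0),\widetilde r_k\rangle=1$. Set $\widetilde\lambda_k(u,v_k,\sigma)=\langle l_k(u_0),A(u)\widetilde r_k(u,v_k,\sigma)\rangle$. For $u^L$ near $u_0$ and small $s>0$ let $\tau\mapsto(u(\tau),v_k(\tau),\sigma(\tau))$, $\tau\in[0,s]$, be the unique (fixed point) solution of $$u(\tau)=u^L+\int_0^\tau\widetilde r_k(u,v_k,\sigma)\,d\xi,\quad v_k(\tau)=\widetilde F_k(\tau)-\mathrm{conv}_{[0,s]}\widetilde F_k(\tau),\quad \sigma(\tau)=\tfrac{d}{d\tau}\mathrm{conv}_{[0,s]}\widetilde F_k(\tau),$$ with $\widetilde F_k(\tau)=\int_0^\tau\widetilde\lambda_k(u(\xi),v_k(\xi),\sigma(\xi))\,d\xi$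 and $\mathrm{conv}_{[0,s]}$ the lower convex envelope on $[0,s]$; for $s<0$ use the upper concave envelope on $[s,0]$. Define $T_k[u^L](s)=u(s)$ and $\sigma_k[u^L](s,\tau)=\sigma(\tau)$. The solution of a Riemann problem $(u^L,u^R)$ with close states is given by the unique small $(s_1,\dots,s_N)$ with $u^R=\Phi(s_1,\dots,s_N)[u^L]:=T_N[\cdots T_2[T_1[u^L](s_1)](s_2)\cdots](s_N)$; $s_k$ is the size of its $k$-wave. **Functionals and domains.** For a piecewise constant $w$ let $s_{x,i}$ be the size of the $i$-wave in the Riemann problem at the jump $x$ and $\sigma_{x,i}(\tau)$, $\tau\in[0,|s_{x,i}|]$, its speed function. Set $\mathcal V(w)=\sum_{x,i}|s_{x,i}|$, $$\mathcal Q(w)=\sum_{i<j,\ x'>x''}|s_{x',i}s_{x'',j}|+\tfrac14\sum_{x',x'',i}\int_0^{|s_{x',i}|}\!\!\int_0^{|s_{x'',i}|}|\sigma_{x',i}(\tau')-\sigma_{x'',i}(\tau'')|\,d\tau'd\tau'',$$ and $\Upsilon=\mathcal V+C_1\mathcal Q$ with $C_1>0$ a suitable constant depending only on $A$. Let $\mathfrak D_p(\delta)$ be the set of piecewise constant $u\in L^1\cap BV$ with $\Upsilon(u)\le\delta$. For general $u\in L^1\cap BV$ the condition $\Upsilon(u)\le\delta$ is understood by closure, i.e. $\mathfrak D(\delta)$ is the closure of $\mathfrak D_p(\delta)$ in $L^1$. **$\varepsilon$-approximate front tracking solution** of $u_t+A(u)u_x=0$ on a time interval $I$: a continuous map $u:I\to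 L^1_{loc}(\mathbb R;\mathbb R^N)$ such that (1) $u(t,x)$ is piecewise constant with discontinuities along finitely many straight segments in the $(t,x)$-plane, each being an elementary or a non-physical front, with finitely many interactions each involving exactly two incoming fronts; (2) along each elementary front $x_\alpha(t)$ the left and right states satisfy $u^R=T_{k_\alpha}[u^L](s_\alpha)$ for some $k_\alpha\in\{1,\dots,N\}$ and some size $s_\alpha$, and $|\dot x_\alpha-\sigma_{k_\alpha}[u^L](s_\alpha,\tau)|\le2\varepsilon$ for all $\tau$ between $0$ and $s_\alpha$; (3) all non-physical fronts travel with a fixed speed $\widehat\lambda>\lambda_k(u)$ for all $u,k$, and the sum of the sizes of their jumps is at most $\varepsilon$ at every time. **Front tracking algorithm.** For $\varepsilon_\nu>0$ and piecewise constant $w$ with $\Upsilon(w)\le\delta_H$ ($\delta_H>0$ a small constant depending only on $A$), $S^{FT}_{t,h}[w]$, $t\ge h$, denotes the $\varepsilon_\nu$-approximate front tracking solution of $u_t+A(u)u_x=0$ with value $w$ at time $h$ generated by the known algorithm for general strictly hyperbolic systems (Ancona–Marson). It satisfies: $\Upsilon(S^{FT}_{t,h}w)\le\Upsilon(w)$; $\|S^{FT}_{t+s,t}w-w\|_{L^1}\le Ls$; and $\|S^{FT}_{h+\tau,h}w-S_{h+\tau,h}w\|_{L^1}\le C\varepsilon_\nu\tau$, with $L,C$ independent of $\nu$. **Fractional step scheme.** Sequences $0<\tau_\nu\le\varepsilon_\nu\downarrow0$ are given. Let $g_\nu(t,x,v)=\frac1{\varepsilon_\nu}\int_{j\varepsilon_\nu}^{(j+1)\varepsilon_\nu}g(t,y,v)\,dy$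 for $x\in[j\varepsilon_\nu,(j+1)\varepsilon_\nu)$, $j\in\mathbb Z$. The approximation with piecewise constant initial datum $\overline w$ is defined by $w_\nu(0+,\cdot)=\overline w$ and, for $n\ge1$, $$w_\nu(t,\cdot)=S^{FT}_{t,(n-1)\tau_\nu}[w_\nu((n-1)\tau_\nu+,\cdot)]\quad\text{for }(n-1)\tau_\nu<t<n\tau_\nu,$$ $$w_\nu(n\tau_\nu+,\cdot)=w_\nu(n\tau_\nu-,\cdot)+\tau_\nu\,g_\nu\big(n\tau_\nu,\cdot,w_\nu(n\tau_\nu-,\cdot)\big).$$ *)

theory Defs
  imports "HOL-Analysis.Analysis"
begin

text \<open>\<open>C\<^sup>k\<close> and \<open>C\<^sup>\<infinity>\<close> regularity; meant for open sets in finite-dimensional spaces, where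
  continuity of all iterated directional derivatives is the usual notion.\<close>

primrec Ck_on :: "nat \<Rightarrow> ('a::real_normed_vector \<Rightarrow> 'b::real_normed_vector) \<Rightarrow> 'a set \<Rightarrow> bool" where
  "Ck_on 0 f S \<longleftrightarrow> continuous_on S f"
| "Ck_on (Suc k) f S \<longleftrightarrow>
     (\<forall>x\<in>S. f differentiable (at x)) \<and> (\<forall>v. Ck_on k (\<lambda>x. frechet_derivative f (at x) v) S)"

definition smooth_on :: "('a::real_normed_vector \<Rightarrow> 'b::real_normed_vector) \<Rightarrow> 'a set \<Rightarrow> bool" where
  "smooth_on f S \<longleftrightarrow> (\<forall>k. Ck_on k f S)"

text \<open>The Bochner integral of a non-integrable function is \<open>0\<close>; \<open>L1_dist\<close> is only used
  together with integrability of both arguments.\<close>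

definition L1_dist :: "(real \<Rightarrow> real^'n) \<Rightarrow> (real \<Rightarrow> real^'n) \<Rightarrow> real" where
  "L1_dist f g = (\<integral>x. norm (f x - g x) \<partial>lborel)"

definition L1_tendsto :: "('a \<Rightarrow> real \<Rightarrow> real^'n) \<Rightarrow> (real \<Rightarrow> real^'n) \<Rightarrow> 'a filter \<Rightarrow> bool" where
  "L1_tendsto f g F \<longleftrightarrow>
     integrable lborel g \<and> (\<forall>\<^sub>F i in F. integrable lborel (f i)) \<and>
     ((\<lambda>i. L1_dist (f i) g) \<longlongrightarrow> 0) F"

definition L1loc_tendsto :: "('a \<Rightarrow> real \<Rightarrow> real^'n) \<Rightarrow> (real \<Rightarrow> real^'n) \<Rightarrow> 'a filter \<Rightarrow> bool" where
  "L1loc_tendsto f g F \<longleftrightarrow>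
     (\<forall>a b. set_integrable lborel {a..b} g \<and>
            (\<forall>\<^sub>F i in F. set_integrable lborel {a..b} (f i)) \<and>
            ((\<lambda>i. LINT x:{a..b}|lborel. norm (f i x - g x)) \<longlongrightarrow> 0) F)"

text \<open>The data of the homogeneous system, of its elementary curves and of the functional
  \<open>\<Upsilon>\<close>. Families are indexed by \<open>k \<in> {1..CARD('n)}\<close>. The radius \<open>nbr\<close> and the bound
  \<open>smallsize\<close> make precise ``near \<open>u\<^sub>0\<close>'' and ``small wave size''.\<close>

record ('n::finite) hyp_sys =
  Om :: "(real^'n) set"
  Amat :: "real^'n \<Rightarrow> real^'n^'n"
  lam :: "nat \<Rightarrow> real^'n \<Rightarrow> real"
  rvec :: "nat \<Rightarrow> real^'n \<Rightarrow> real^'n"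
  lvec :: "nat \<Rightarrow> real^'n \<Rightarrow> real^'n"
  u0 :: "real^'n"
  rt :: "nat \<Rightarrow> (real^'n) \<times> real \<times> real \<Rightarrow> real^'n"
  nbr :: real
  smallsize :: real
  C1 :: real

definition strictly_hyperbolic :: "('n::finite) hyp_sys \<Rightarrow> bool" where
  "strictly_hyperbolic H \<longleftrightarrow>
     open (Om H) \<and> connected (Om H) \<and> Om H \<noteq> {} \<and> smooth_on (Amat H) (Om H) \<and>
     (\<forall>u\<in>Om H. \<forall>k\<in>{1..CARD('n)}.
        Amat H u *v rvec H k u = lam H k u *\<^sub>R rvec H k u \<and>
        lvec H k u v* Amat H u = lam H k u *\<^sub>R lvec H k u \<and>
        norm (rvec H k u) = 1 \<and>
        (\<forall>h\<in>{1..CARD('n)}. rvec H k u \<bullet> lvec H h u = (if k = h then 1 else 0)) \<and>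
        (\<forall>h\<in>{1..CARD('n)}. k < h \<longrightarrow> lam H k u < lam H h u)) \<and>
     (\<exists>lamhat :: nat \<Rightarrow> real.
        (\<forall>k\<in>{1..CARD('n)}. lamhat (k - 1) < lamhat k) \<and>
        (\<forall>u\<in>Om H. \<forall>k\<in>{1..CARD('n)}. lamhat (k - 1) < lam H k u \<and> lam H k u < lamhat k))"

text \<open>In the last conjunct, Lipschitz continuity already makes \<open>g(t,\<cdot>,u)\<close> differentiable
  almost everywhere.\<close>

definition source_assumption ::
    "(real^'n) set \<Rightarrow> (real \<Rightarrow> real \<Rightarrow> real^('n::finite) \<Rightarrow> real^'n) \<Rightarrow> bool" where
  "source_assumption \<Omega> g \<longleftrightarrow>
     (\<forall>t\<ge>0. \<forall>x. \<exists>Du :: real^'n \<Rightarrow> (real^'n) \<Rightarrow>\<^sub>L (real^'n).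
        (\<forall>u\<in>\<Omega>. (g t x has_derivative blinfun_apply (Du u)) (at u)) \<and> continuous_on \<Omega> Du) \<and>
     (\<forall>x. \<forall>u\<in>\<Omega>. continuous_on {0..} (\<lambda>t. g t x u)) \<and>
     (\<exists>K. \<forall>t\<ge>0. \<forall>x y. \<forall>u\<in>\<Omega>. \<forall>v\<in>\<Omega>.
        norm (g t x u - g t y v) \<le> K * (\<bar>x - y\<bar> + norm (u - v))) \<and>
     (\<exists>\<alpha> :: real \<Rightarrow> real. integrable lborel \<alpha> \<and>
        (\<forall>t\<ge>0. \<forall>u\<in>\<Omega>. AE x in lborel. \<forall>D.
           ((\<lambda>y. g t y u) has_vector_derivative D) (at x) \<longrightarrow> norm D \<le> \<alpha> x))"

text \<open>Classical solution, of uniformly bounded total variation, of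
  \<open>u\<^sub>t + A(u) u\<^sub>x = g(t,x,u) + \<epsilon> u\<^sub>x\<^sub>x\<close>, \<open>u(h,\<cdot>) = w\<close>, on a time interval \<open>J\<close> with left endpoint
  \<open>h \<in> J\<close>; the initial datum, which may be discontinuous, is attained in \<open>L\<^sup>1\<^sub>l\<^sub>o\<^sub>c\<close>.\<close>

definition viscous_solution ::
    "(real^'n) set \<Rightarrow> (real^('n::finite) \<Rightarrow> real^'n^'n) \<Rightarrow> (real \<Rightarrow> real \<Rightarrow> real^'n \<Rightarrow> real^'n) \<Rightarrow>
     real \<Rightarrow> real \<Rightarrow> real set \<Rightarrow> (real \<Rightarrow> real^'n) \<Rightarrow> (real \<Rightarrow> real \<Rightarrow> real^'n) \<Rightarrow> bool" where
  "viscous_solution \<Omega> A g \<epsilon> h J w u \<longleftrightarrow>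
     u h = w \<and> L1loc_tendsto u w (at h within J) \<and>
     (\<exists>ut ux uxx :: real \<Rightarrow> real \<Rightarrow> real^'n.
        (\<forall>t\<in>J - {h}. \<forall>x.
           u t x \<in> \<Omega> \<and>
           ((\<lambda>s. u s x) has_vector_derivative ut t x) (at t within J) \<and>
           (u t has_vector_derivative ux t x) (at x) \<and>
           (ux t has_vector_derivative uxx t x) (at x) \<and>
           ut t x + A (u t x) *v ux t x = g t x (u t x) + \<epsilon> *\<^sub>R uxx t x) \<and>
        continuous_on ((J - {h}) \<times> UNIV) (\<lambda>(t, x). ut t x) \<and>
        continuous_on ((J - {h}) \<times> UNIV) (\<lambda>(t, x). ux t x) \<and>
        continuous_on ((J - {h}) \<times> UNIV) (\<lambda>(t, x). uxx t x) \<and>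
        (\<exists>M. \<forall>t\<in>J - {h}. integrable lborel (ux t) \<and> (\<integral>x. norm (ux t x) \<partial>lborel) \<le> M))"

definition vanishing_viscosity_solution ::
    "(real^'n) set \<Rightarrow> (real^('n::finite) \<Rightarrow> real^'n^'n) \<Rightarrow> (real \<Rightarrow> real \<Rightarrow> real^'n \<Rightarrow> real^'n) \<Rightarrow>
     real \<Rightarrow> real set \<Rightarrow> (real \<Rightarrow> real^'n) \<Rightarrow> (real \<Rightarrow> real \<Rightarrow> real^'n) \<Rightarrow> bool" where
  "vanishing_viscosity_solution \<Omega> A g h J w p \<longleftrightarrow>
     (\<exists>U :: real \<Rightarrow> real \<Rightarrow> real \<Rightarrow> real^'n.
        (\<forall>\<^sub>F \<epsilon> in at_right 0. viscous_solution \<Omega> A g \<epsilon> h J w (U \<epsilon>)) \<and>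
        (\<forall>t\<in>J. L1loc_tendsto (\<lambda>\<epsilon>. U \<epsilon> t) (p t) (at_right 0)))"

text \<open>\<open>P t h w\<close> stands for \<open>P\<^bsub>t,h\<^esub>[w]\<close>, and \<open>E h\<close> is the set of data at time \<open>h\<close> under
  consideration, i.e. those for which the vanishing viscosity solution is available. Elements of \<open>L\<^sup>1\<close> are represented by functions, so identities between them hold
  almost everywhere.\<close>

definition viscous_solution_operator ::
    "(real^'n) set \<Rightarrow> (real^('n::finite) \<Rightarrow> real^'n^'n) \<Rightarrow> (real \<Rightarrow> real \<Rightarrow> real^'n \<Rightarrow> real^'n) \<Rightarrow>
     real \<Rightarrow> (real \<Rightarrow> (real \<Rightarrow> real^'n) set) \<Rightarrow>
     (real \<Rightarrow> real \<Rightarrow> (real \<Rightarrow> real^'n) \<Rightarrow> real \<Rightarrow> real^'n) \<Rightarrow> bool" where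
  "viscous_solution_operator \<Omega> A g T E P \<longleftrightarrow>
     (\<forall>h\<in>{0..T}. \<forall>w\<in>E h.
        integrable lborel w \<and>
        vanishing_viscosity_solution \<Omega> A g h {h..T} w (\<lambda>t. P t h w) \<and>
        (\<forall>t\<in>{h..T}. P t h w \<in> E t)) \<and>
     (\<exists>L>0. \<forall>h\<in>{0..T}. \<forall>t1\<in>{h..T}. \<forall>t2\<in>{h..T}. \<forall>w1\<in>E h. \<forall>w2\<in>E h.
        L1_dist (P t1 h w1) (P t2 h w2) \<le> L * (L1_dist w1 w2 + \<bar>t2 - t1\<bar>)) \<and>
     (\<forall>t0 t1 t2. 0 \<le> t0 \<and> t0 \<le> t1 \<and> t1 \<le> t2 \<and> t2 \<le> T \<longrightarrow>
        (\<forall>w\<in>E t0. AE x in lborel. P t2 t0 w x = P t2 t1 (P t1 t0 w) x))"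

definition nbhd :: "('n::finite) hyp_sys \<Rightarrow> nat \<Rightarrow> ((real^'n) \<times> real \<times> real) set" where
  "nbhd H k = ball (u0 H) (nbr H) \<times> ball 0 (nbr H) \<times> ball (lam H k (u0 H)) (nbr H)"

text \<open>The graph \<open>v = v\<^sub>k rt\<^sub>k(u, v\<^sub>k, \<sigma>)\<close>, \<open>v\<^sub>k = \<langle>l\<^sub>k(u\<^sub>0), v\<rangle>\<close>, is a center manifold of
  \<open>u' = v, v' = (A(u) - \<sigma>) v, \<sigma>' = 0\<close> at \<open>(u\<^sub>0, 0, \<lambda>\<^sub>k(u\<^sub>0))\<close>: it is parametrized by the
  \<open>N + 2\<close> coordinates \<open>(u, v\<^sub>k, \<sigma>)\<close>, locally invariant, and, because of
  \<open>rt\<^sub>k(u\<^sub>0, 0, \<sigma>) = r\<^sub>k(u\<^sub>0)\<close>, tangent at the equilibrium to the center subspace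
  \<open>{v \<in> span r\<^sub>k(u\<^sub>0)}\<close>. Center manifolds of smooth systems are in general only smooth of finite
  order; \<open>C\<^sup>2\<close> is all that is required here.\<close>

definition center_manifold :: "('n::finite) hyp_sys \<Rightarrow> nat \<Rightarrow> bool" where
  "center_manifold H k \<longleftrightarrow>
     Ck_on 2 (rt H k) (nbhd H k) \<and>
     (\<forall>\<sigma>\<in>ball (lam H k (u0 H)) (nbr H). rt H k (u0 H, 0, \<sigma>) = rvec H k (u0 H)) \<and>
     (\<forall>p\<in>nbhd H k. lvec H k (u0 H) \<bullet> rt H k p = 1) \<and>
     (\<forall>a b (u :: real \<Rightarrow> real^'n) v \<sigma>.
        let vk = (\<lambda>t. lvec H k (u0 H) \<bullet> v t);
            on_manifold = (\<lambda>t. v t = vk t *\<^sub>R rt H k (u t, vk t, \<sigma>))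
        in (\<forall>t\<in>{a..b}. (u t, vk t, \<sigma>) \<in> nbhd H k \<and>
              (u has_vector_derivative v t) (at t within {a..b}) \<and>
              (v has_vector_derivative (Amat H (u t) *v v t - \<sigma> *\<^sub>R v t)) (at t within {a..b})) \<longrightarrow>
           (\<exists>t\<in>{a..b}. on_manifold t) \<longrightarrow> (\<forall>t\<in>{a..b}. on_manifold t))"

definition elementary_data :: "('n::finite) hyp_sys \<Rightarrow> bool" where
  "elementary_data H \<longleftrightarrow>
     u0 H \<in> Om H \<and> 0 < nbr H \<and> ball (u0 H) (nbr H) \<subseteq> Om H \<and> 0 < smallsize H \<and>
     (\<forall>k\<in>{1..CARD('n)}. center_manifold H k)"

definition lamt :: "('n::finite) hyp_sys \<Rightarrow> nat \<Rightarrow> (real^'n) \<times> real \<times> real \<Rightarrow> real" where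
  "lamt H k p = lvec H k (u0 H) \<bullet> (Amat H (fst p) *v rt H k p)"

definition lower_convex_envelope :: "real \<Rightarrow> real \<Rightarrow> (real \<Rightarrow> real) \<Rightarrow> real \<Rightarrow> real" where
  "lower_convex_envelope a b F x =
     Sup {\<phi> x |\<phi>. convex_on {a..b} \<phi> \<and> (\<forall>y\<in>{a..b}. \<phi> y \<le> F y)}"

definition upper_concave_envelope :: "real \<Rightarrow> real \<Rightarrow> (real \<Rightarrow> real) \<Rightarrow> real \<Rightarrow> real" where
  "upper_concave_envelope a b F x =
     Inf {\<phi> x |\<phi>. concave_on {a..b} \<phi> \<and> (\<forall>y\<in>{a..b}. F y \<le> \<phi> y)}"

definition envelope :: "real \<Rightarrow> (real \<Rightarrow> real) \<Rightarrow> real \<Rightarrow> real" where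
  "envelope s F = (if 0 \<le> s then lower_convex_envelope 0 s F else upper_concave_envelope s 0 F)"

definition curve_system ::
    "('n::finite) hyp_sys \<Rightarrow> nat \<Rightarrow> real^'n \<Rightarrow> real \<Rightarrow> (real \<Rightarrow> (real^'n) \<times> real \<times> real) \<Rightarrow> bool" where
  "curve_system H k uL s \<gamma> \<longleftrightarrow>
     (let I = closed_segment 0 s;
          F = (\<lambda>\<tau>. LBINT \<xi>=ereal 0..ereal \<tau>. lamt H k (\<gamma> \<xi>))
      in continuous_on I \<gamma> \<and> \<gamma> ` I \<subseteq> nbhd H k \<and>
         (\<forall>\<tau>\<in>I. case \<gamma> \<tau> of (u, v, \<sigma>) \<Rightarrow>
            u = uL + (LBINT \<xi>=ereal 0..ereal \<tau>. rt H k (\<gamma> \<xi>)) \<and>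
            v = F \<tau> - envelope s F \<tau> \<and>
            (envelope s F has_real_derivative \<sigma>) (at \<tau> within I)))"

text \<open>A curve of size \<open>0\<close> is the single point \<open>u\<^sup>L\<close>; the system would leave its speed
  undetermined.\<close>

definition curve_wellposed :: "('n::finite) hyp_sys \<Rightarrow> nat \<Rightarrow> real^'n \<Rightarrow> real \<Rightarrow> bool" where
  "curve_wellposed H k uL s \<longleftrightarrow>
     s = 0 \<or>
     (\<exists>\<gamma>. curve_system H k uL s \<gamma> \<and>
          (\<forall>\<gamma>'. curve_system H k uL s \<gamma>' \<longrightarrow> (\<forall>\<tau>\<in>closed_segment 0 s. \<gamma>' \<tau> = \<gamma> \<tau>)))"

definition curve :: "('n::finite) hyp_sys \<Rightarrow> nat \<Rightarrow> real^'n \<Rightarrow> real \<Rightarrow> real \<Rightarrow> (real^'n) \<times> real \<times> real" where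
  "curve H k uL s = (SOME \<gamma>. curve_system H k uL s \<gamma>)"

definition Tcurve :: "('n::finite) hyp_sys \<Rightarrow> nat \<Rightarrow> real^'n \<Rightarrow> real \<Rightarrow> real^'n" where
  "Tcurve H k uL s = (if s = 0 then uL else fst (curve H k uL s s))"

definition speed :: "('n::finite) hyp_sys \<Rightarrow> nat \<Rightarrow> real^'n \<Rightarrow> real \<Rightarrow> real \<Rightarrow> real" where
  "speed H k uL s \<tau> = snd (snd (curve H k uL s \<tau>))"

text \<open>\<open>riemann_state H uL s k = T\<^sub>k[\<dots>T\<^sub>1[u\<^sup>L](s\<^sub>1)\<dots>](s\<^sub>k)\<close>; for \<open>k = N\<close> this is
  \<open>\<Phi>(s\<^sub>1,\<dots>,s\<^sub>N)[u\<^sup>L]\<close>.\<close>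

primrec riemann_state :: "('n::finite) hyp_sys \<Rightarrow> real^'n \<Rightarrow> (nat \<Rightarrow> real) \<Rightarrow> nat \<Rightarrow> real^'n" where
  "riemann_state H uL s 0 = uL"
| "riemann_state H uL s (Suc k) = Tcurve H (Suc k) (riemann_state H uL s k) (s (Suc k))"

definition riemann_sizes :: "('n::finite) hyp_sys \<Rightarrow> real^'n \<Rightarrow> real^'n \<Rightarrow> (nat \<Rightarrow> real) \<Rightarrow> bool" where
  "riemann_sizes H uL uR s \<longleftrightarrow>
     (\<forall>k\<in>{1..CARD('n)}. \<bar>s k\<bar> \<le> smallsize H \<and>
        curve_wellposed H k (riemann_state H uL s (k - 1)) (s k)) \<and>
     (\<forall>k. k \<notin> {1..CARD('n)} \<longrightarrow> s k = 0) \<and>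
     riemann_state H uL s CARD('n) = uR"

definition riemann_solvable :: "('n::finite) hyp_sys \<Rightarrow> real^'n \<Rightarrow> real^'n \<Rightarrow> bool" where
  "riemann_solvable H uL uR \<longleftrightarrow> (\<exists>!s. riemann_sizes H uL uR s)"

definition piecewise_constant :: "(real \<Rightarrow> real^'n) \<Rightarrow> bool" where
  "piecewise_constant w \<longleftrightarrow>
     (\<exists>F. finite F \<and> (\<forall>a b. {a<..<b} \<inter> F = {} \<longrightarrow> (\<exists>c. \<forall>x\<in>{a<..<b}. w x = c)))"

definition left_state :: "(real \<Rightarrow> real^'n) \<Rightarrow> real \<Rightarrow> real^'n" where
  "left_state w x = Lim (at_left x) w"

definition right_state :: "(real \<Rightarrow> real^'n) \<Rightarrow> real \<Rightarrow> real^'n" where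
  "right_state w x = Lim (at_right x) w"

definition jumps :: "(real \<Rightarrow> real^'n) \<Rightarrow> real set" where
  "jumps w = {x. left_state w x \<noteq> right_state w x}"

definition wave_sizes :: "('n::finite) hyp_sys \<Rightarrow> (real \<Rightarrow> real^'n) \<Rightarrow> real \<Rightarrow> nat \<Rightarrow> real" where
  "wave_sizes H w x = (THE s. riemann_sizes H (left_state w x) (right_state w x) s)"

text \<open>Speed function on \<open>[0, \<bar>s\<^bsub>x,i\<^esub>\<bar>]\<close>: for negative sizes, the parameter interval \<open>[s, 0]\<close>
  of the curve is reflected.\<close>

definition wave_speed :: "('n::finite) hyp_sys \<Rightarrow> (real \<Rightarrow> real^'n) \<Rightarrow> real \<Rightarrow> nat \<Rightarrow> real \<Rightarrow> real" where
  "wave_speed H w x i \<tau> =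
     (let s = wave_sizes H w x
      in speed H i (riemann_state H (left_state w x) s (i - 1)) (s i) (sgn (s i) * \<tau>))"

definition Vfun :: "('n::finite) hyp_sys \<Rightarrow> (real \<Rightarrow> real^'n) \<Rightarrow> real" where
  "Vfun H w = (\<Sum>x\<in>jumps w. \<Sum>i\<in>{1..CARD('n)}. \<bar>wave_sizes H w x i\<bar>)"

definition Qfun :: "('n::finite) hyp_sys \<Rightarrow> (real \<Rightarrow> real^'n) \<Rightarrow> real" where
  "Qfun H w =
     (\<Sum>x'\<in>jumps w. \<Sum>x''\<in>{x''\<in>jumps w. x'' < x'}. \<Sum>j\<in>{1..CARD('n)}. \<Sum>i\<in>{1..<j}.
        \<bar>wave_sizes H w x' i * wave_sizes H w x'' j\<bar>) +
     1/4 * (\<Sum>x'\<in>jumps w. \<Sum>x''\<in>jumps w. \<Sum>i\<in>{1..CARD('n)}.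
        (LBINT \<tau>'=ereal 0..ereal \<bar>wave_sizes H w x' i\<bar>.
          (LBINT \<tau>''=ereal 0..ereal \<bar>wave_sizes H w x'' i\<bar>.
             \<bar>wave_speed H w x' i \<tau>' - wave_speed H w x'' i \<tau>''\<bar>)))"

definition Upsilon :: "('n::finite) hyp_sys \<Rightarrow> (real \<Rightarrow> real^'n) \<Rightarrow> real" where
  "Upsilon H w = Vfun H w + C1 H * Qfun H w"

text \<open>Piecewise constant functions with finitely many jumps have bounded variation. Solvability of
  the Riemann problems at the jumps is what makes \<open>\<Upsilon>\<close> defined.\<close>

definition Dp :: "('n::finite) hyp_sys \<Rightarrow> real \<Rightarrow> (real \<Rightarrow> real^'n) set" where
  "Dp H \<delta> =
     {w. piecewise_constant w \<and> integrable lborel w \<and>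
         (\<forall>x\<in>jumps w. riemann_solvable H (left_state w x) (right_state w x)) \<and>
         Upsilon H w \<le> \<delta>}"

text \<open>By lower semicontinuity of the variation, the elements of the closure are again (almost
  everywhere equal to) functions of bounded variation.\<close>

definition Dom :: "('n::finite) hyp_sys \<Rightarrow> real \<Rightarrow> (real \<Rightarrow> real^'n) set" where
  "Dom H \<delta> = {u. integrable lborel u \<and> (\<forall>e>0. \<exists>w\<in>Dp H \<delta>. L1_dist w u < e)}"

datatype front_kind = Elementary nat real | NonPhysical

text \<open>A front is a straight segment, possibly a half-line, in the \<open>(t,x)\<close>-plane.\<close>

record front =
  fstart :: real
  fend :: ereal
  fpos :: real
  fspeed :: real
  fkind :: front_kind

definition front_at :: "front \<Rightarrow> real \<Rightarrow> real" where
  "front_at f t = fpos f + fspeed f * (t - fstart f)"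

definition front_segment :: "front \<Rightarrow> (real \<times> real) set" where
  "front_segment f = {(t, front_at f t) |t. fstart f \<le> t \<and> ereal t \<le> fend f}"

definition alive :: "front \<Rightarrow> real \<Rightarrow> bool" where
  "alive f t \<longleftrightarrow> fstart f < t \<and> ereal t < fend f"

text \<open>Fronts begin and end only at the initial time or at interaction points; an interaction point
  is the common endpoint of exactly two incoming fronts.\<close>

definition approx_front_tracking ::
    "('n::finite) hyp_sys \<Rightarrow> real \<Rightarrow> real \<Rightarrow> (real \<Rightarrow> real \<Rightarrow> real^'n) \<Rightarrow> bool" where
  "approx_front_tracking H \<epsilon> h u \<longleftrightarrow>
     (\<forall>t\<ge>h. L1loc_tendsto u (u t) (at t within {h..})) \<and>
     (\<exists>Fr lamNP. finite Fr \<and>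
        (\<forall>f\<in>Fr. h \<le> fstart f \<and> ereal (fstart f) < fend f) \<and>
        (\<forall>C. connected C \<and> C \<subseteq> {h..} \<times> UNIV - (\<Union>f\<in>Fr. front_segment f) \<longrightarrow>
             (\<exists>c. \<forall>(t, x)\<in>C. u t x = c)) \<and>
        (\<forall>f\<in>Fr. \<forall>f'\<in>Fr. f \<noteq> f' \<longrightarrow>
             (\<forall>t. alive f t \<longrightarrow> (t, front_at f t) \<notin> front_segment f')) \<and>
        (\<forall>t>h. \<forall>x.
           (\<exists>f\<in>Fr. (fstart f = t \<or> fend f = ereal t) \<and> front_at f t = x) \<longrightarrow>
           card {f\<in>Fr. fend f = ereal t \<and> front_at f t = x} = 2) \<and>
        (\<forall>f\<in>Fr. \<forall>k s. fkind f = Elementary k s \<longrightarrow>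
           k \<in> {1..CARD('n)} \<and> s \<noteq> 0 \<and>
           (\<forall>t. alive f t \<longrightarrow>
              (let uL = left_state (u t) (front_at f t); uR = right_state (u t) (front_at f t)
               in curve_wellposed H k uL s \<and> uR = Tcurve H k uL s \<and>
                  (\<forall>\<tau>\<in>closed_segment 0 s. \<bar>fspeed f - speed H k uL s \<tau>\<bar> \<le> 2 * \<epsilon>)))) \<and>
        (\<forall>v\<in>Om H. \<forall>k\<in>{1..CARD('n)}. lam H k v < lamNP) \<and>
        (\<forall>f\<in>Fr. fkind f = NonPhysical \<longrightarrow> fspeed f = lamNP) \<and>
        (\<forall>t\<ge>h. (\<Sum>f\<in>{f\<in>Fr. fkind f = NonPhysical \<and> alive f t}.
             norm (right_state (u t) (front_at f t) - left_state (u t) (front_at f t))) \<le> \<epsilon>))"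

text \<open>\<open>S t h w\<close> stands for \<open>S\<^bsub>t,h\<^esub>[w]\<close>, the operator of the homogeneous system.\<close>

definition homogeneous_operator ::
    "('n::finite) hyp_sys \<Rightarrow> real \<Rightarrow> (real \<Rightarrow> real \<Rightarrow> (real \<Rightarrow> real^'n) \<Rightarrow> real \<Rightarrow> real^'n) \<Rightarrow> bool" where
  "homogeneous_operator H \<delta>H S \<longleftrightarrow>
     (\<forall>h\<ge>0. \<forall>w\<in>Dp H \<delta>H.
        vanishing_viscosity_solution (Om H) (Amat H) (\<lambda>t x u. 0) h {h..} w (\<lambda>t. S t h w) \<and>
        (\<forall>t\<ge>h. integrable lborel (S t h w)))"

text \<open>The algorithm enters through its output and its estimates; \<open>SFT \<nu> t h w\<close> stands for
  \<open>S\<^sup>F\<^sup>T\<^bsub>t,h\<^esub>[w]\<close> with parameter \<open>\<epsilon>\<^sub>\<nu>\<close>.\<close>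

definition front_tracking_algorithm ::
    "('n::finite) hyp_sys \<Rightarrow> real \<Rightarrow> (nat \<Rightarrow> real) \<Rightarrow>
     (real \<Rightarrow> real \<Rightarrow> (real \<Rightarrow> real^'n) \<Rightarrow> real \<Rightarrow> real^'n) \<Rightarrow>
     (nat \<Rightarrow> real \<Rightarrow> real \<Rightarrow> (real \<Rightarrow> real^'n) \<Rightarrow> real \<Rightarrow> real^'n) \<Rightarrow> bool" where
  "front_tracking_algorithm H \<delta>H \<epsilon> S SFT \<longleftrightarrow>
     (\<forall>\<nu>. \<forall>h\<ge>0. \<forall>w\<in>Dp H \<delta>H.
        approx_front_tracking H (\<epsilon> \<nu>) h (\<lambda>t. SFT \<nu> t h w) \<and>
        (AE x in lborel. SFT \<nu> h h w x = w x) \<and>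
        (\<forall>t\<ge>h. SFT \<nu> t h w \<in> Dp H \<delta>H \<and> Upsilon H (SFT \<nu> t h w) \<le> Upsilon H w)) \<and>
     (\<exists>L. \<forall>\<nu>. \<forall>t\<ge>0. \<forall>s\<ge>0. \<forall>w\<in>Dp H \<delta>H.
        L1_dist (SFT \<nu> (t + s) t w) w \<le> L * s) \<and>
     (\<exists>C. \<forall>\<nu>. \<forall>h\<ge>0. \<forall>\<tau>\<ge>0. \<forall>w\<in>Dp H \<delta>H.
        L1_dist (SFT \<nu> (h + \<tau>) h w) (S (h + \<tau>) h w) \<le> C * \<epsilon> \<nu> * \<tau>)"

definition cell_average ::
    "(real \<Rightarrow> real \<Rightarrow> real^'n \<Rightarrow> real^('n::finite)) \<Rightarrow> real \<Rightarrow> real \<Rightarrow> real \<Rightarrow> real^'n \<Rightarrow> real^'n" where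
  "cell_average g \<epsilon> t x v =
     (let j = real_of_int \<lfloor>x / \<epsilon>\<rfloor>
      in (1 / \<epsilon>) *\<^sub>R (LBINT y=ereal (j * \<epsilon>)..ereal ((j + 1) * \<epsilon>). g t y v))"

text \<open>\<open>fs_node F g \<epsilon> \<tau> w n\<close> is \<open>w\<^sub>\<nu>(n\<tau>+,\<cdot>)\<close>, with \<open>F\<close> the front tracking operator. Since a front
  tracking solution is continuous into \<open>L\<^sup>1\<^sub>l\<^sub>o\<^sub>c\<close>, the left limit \<open>w\<^sub>\<nu>(n\<tau>-,\<cdot>)\<close> is its value at
  the end of the time step.\<close>

primrec fs_node ::
    "(real \<Rightarrow> real \<Rightarrow> (real \<Rightarrow> real^'n) \<Rightarrow> real \<Rightarrow> real^'n) \<Rightarrow>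
     (real \<Rightarrow> real \<Rightarrow> real^'n \<Rightarrow> real^('n::finite)) \<Rightarrow>
     real \<Rightarrow> real \<Rightarrow> (real \<Rightarrow> real^'n) \<Rightarrow> nat \<Rightarrow> real \<Rightarrow> real^'n" where
  "fs_node F g \<epsilon> \<tau> w 0 = w"
| "fs_node F g \<epsilon> \<tau> w (Suc n) =
     (let wm = F (real (Suc n) * \<tau>) (real n * \<tau>) (fs_node F g \<epsilon> \<tau> w n)
      in (\<lambda>x. wm x + \<tau> *\<^sub>R cell_average g \<epsilon> (real (Suc n) * \<tau>) x (wm x)))"

text \<open>Right-continuous convention: the value at a time step \<open>n\<tau>\<close> is \<open>w\<^sub>\<nu>(n\<tau>+,\<cdot>)\<close>.\<close>

definition fs_approx ::
    "(real \<Rightarrow> real \<Rightarrow> (real \<Rightarrow> real^'n) \<Rightarrow> real \<Rightarrow> real^'n) \<Rightarrow>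
     (real \<Rightarrow> real \<Rightarrow> real^'n \<Rightarrow> real^('n::finite)) \<Rightarrow>
     real \<Rightarrow> real \<Rightarrow> (real \<Rightarrow> real^'n) \<Rightarrow> real \<Rightarrow> real \<Rightarrow> real^'n" where
  "fs_approx F g \<epsilon> \<tau> w t =
     (let n = nat \<lfloor>t / \<tau>\<rfloor>; z = fs_node F g \<epsilon> \<tau> w n
      in if t = real n * \<tau> then z else F t (real n * \<tau>) z)"

text \<open>The scheme can be carried out on \<open>[0,T]\<close>: every state from which a time step starts lies in
  the domain of the front tracking algorithm and in that of \<open>P\<close>.\<close>

definition fs_constructible ::
    "('n::finite) hyp_sys \<Rightarrow> real \<Rightarrow> (real \<Rightarrow> (real \<Rightarrow> real^'n) set) \<Rightarrow>
     (real \<Rightarrow> real \<Rightarrow> (real \<Rightarrow> real^'n) \<Rightarrow> real \<Rightarrow> real^'n) \<Rightarrow>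
     (real \<Rightarrow> real \<Rightarrow> real^'n \<Rightarrow> real^'n) \<Rightarrow> real \<Rightarrow> real \<Rightarrow> real \<Rightarrow> (real \<Rightarrow> real^'n) \<Rightarrow> bool" where
  "fs_constructible H \<delta>H E F g \<epsilon> \<tau> T w \<longleftrightarrow>
     (\<forall>n. real n * \<tau> < T \<longrightarrow>
        fs_node F g \<epsilon> \<tau> w n \<in> Dp H \<delta>H \<and> fs_node F g \<epsilon> \<tau> w n \<in> E (real n * \<tau>))"

end

theory Submission
  imports Defs
begin

text \<open>
  Both the scheme and the operator \<open>P\<close> are compared along the same time grid. By the semigroup
  property, the distance between the \<open>n\<close>-th node of the scheme and \<open>P\<close> applied to its initial
  datum is at most the sum of the errors committed in the single steps, each of them transported
  by \<open>P\<close> up to the final time and so amplified at most by the Lipschitz constant of \<open>P\<close>. On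
  \<open>[0,T]\<close> there are at most \<open>T / \<tau>\<close> steps, so a one-step error of order
  \<open>o(\<tau>) + \<epsilon> \<tau>\<close> adds up to a quantity of order \<open>o(\<tau>) / \<tau> + \<epsilon>\<close>, which vanishes
  (lemmas \<open>node_error\<close> and \<open>fs_approx_error\<close>). Between two nodes both evolutions move by
  \<open>O(\<tau>)\<close>. Hence the scheme with a fixed datum \<open>w\<close> converges to \<open>P\<close> applied to \<open>w\<close>, and the
  Lipschitz dependence of \<open>P\<close> on the datum passes from \<open>w\<close> to its limit \<open>u\<close>.

  The delicate point is the order of the limits: the constant in front of the one-step error may
  depend on the datum \<open>w\<close>, and may blow up along a sequence of piecewise constant approximations
  \<open>z\<^sub>k\<close> of \<open>u\<close>. This is why the approximations have to be chosen suitably: one takes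
  \<open>z\<^bsub>m(\<nu>)\<^esub>\<close> as the datum of the \<open>\<nu>\<close>-th scheme, where \<open>m(\<nu>)\<close> tends to infinity so slowly that the
  constant of \<open>z\<^bsub>m(\<nu>)\<^esub>\<close> is beaten by the decay of \<open>o(\<tau>\<^sub>\<nu>) / \<tau>\<^sub>\<nu> + \<epsilon>\<^sub>\<nu>\<close> (lemma
  \<open>slow_diagonal\<close>). The argument gives convergence at every time of \<open>[0,T]\<close>.
\<close>

section \<open>The distance in \<open>L\<^sup>1\<close>\<close>

lemma L1_dist_nonneg: "0 \<le> L1_dist f g"
  by (simp add: L1_dist_def)

lemma L1_dist_commute: "L1_dist f g = L1_dist g f"
  by (simp add: L1_dist_def norm_minus_commute)

lemma L1_dist_triangle:
  assumes "integrable lborel f" "integrable lborel g" "integrable lborel h"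
  shows "L1_dist f h \<le> L1_dist f g + L1_dist g h"
proof -
  have "L1_dist f h \<le> (\<integral>x. norm (f x - g x) + norm (g x - h x) \<partial>lborel)"
    unfolding L1_dist_def
    using assms by (intro integral_mono) (auto intro: norm_diff_triangle_le)
  also have "\<dots> = L1_dist f g + L1_dist g h"
    unfolding L1_dist_def using assms by (intro Bochner_Integration.integral_add) auto
  finally show ?thesis .
qed

lemma L1_dist_eq_0_AE:
  assumes "AE x in lborel. f x = g x"
  shows "L1_dist f g = 0"
  unfolding L1_dist_def by (rule integral_eq_zero_AE) (use assms in auto)

lemma L1loc_tendsto_const_AE_eq:
  fixes w p :: "real \<Rightarrow> real^'n"
  assumes lim: "L1loc_tendsto f p F" and ev: "\<forall>\<^sub>F i in F. f i = w" and F: "F \<noteq> bot"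
  shows "AE x in lborel. w x = p x"
proof -
  have "AE x in lborel. x \<in> {- real m..real m} \<longrightarrow> w x = p x" for m
  proof -
    let ?I = "{- real m..real m}"
    have p: "set_integrable lborel ?I p" and ev_int: "\<forall>\<^sub>F i in F. set_integrable lborel ?I (f i)"
      and lim0: "((\<lambda>i. LINT x:?I|lborel. norm (f i x - p x)) \<longlongrightarrow> 0) F"
      using lim unfolding L1loc_tendsto_def by blast+
    have "\<forall>\<^sub>F i in F. set_integrable lborel ?I w"
      using ev ev_int by eventually_elim simp
    then have w: "set_integrable lborel ?I w"
      using F by (simp add: eventually_const)
    have "((\<lambda>i. LINT x:?I|lborel. norm (w x - p x)) \<longlongrightarrow> 0) F"
      by (rule Lim_transform_eventually[OF lim0]) (use ev in eventually_elim, simp)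
    then have zero: "(LINT x:?I|lborel. norm (w x - p x)) = 0"
      using F by (simp add: tendsto_const_iff)
    have int: "integrable lborel (\<lambda>x. indicator ?I x *\<^sub>R norm (w x - p x))"
      using set_integrable_norm[OF set_integral_diff(1)[OF w p]]
      by (simp add: set_integrable_def)
    have "AE x in lborel. indicator ?I x *\<^sub>R norm (w x - p x) = 0"
      using zero integral_nonneg_eq_0_iff_AE[OF int] by (simp add: set_lebesgue_integral_def)
    then show ?thesis
      by (rule AE_mp) (auto simp: indicator_def intro!: AE_I2)
  qed
  then have "AE x in lborel. \<forall>m::nat. x \<in> {- real m..real m} \<longrightarrow> w x = p x"
    by (subst AE_all_countable) blast
  then show ?thesis
  proof (rule AE_mp, intro AE_I2 impI)
    fix x :: real
    assume *: "\<forall>m::nat. x \<in> {- real m..real m} \<longrightarrow> w x = p x"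
    obtain m :: nat where "\<bar>x\<bar> \<le> real m"
      using real_arch_simple by blast
    then show "w x = p x"
      using * by (auto simp: abs_le_iff)
  qed
qed

section \<open>Lipschitz evolution operators and one-step methods\<close>

text \<open>The features of the vanishing viscosity operator that matter for comparing it with a
  one-step method.\<close>

locale lipschitz_evolution =
  fixes T :: real
    and E :: "real \<Rightarrow> (real \<Rightarrow> real^'n) set"
    and P :: "real \<Rightarrow> real \<Rightarrow> (real \<Rightarrow> real^'n) \<Rightarrow> real \<Rightarrow> real^'n"
    and L :: real
  assumes L_nonneg: "0 \<le> L"
    and E_integrable: "\<lbrakk>0 \<le> h; h \<le> T; w \<in> E h\<rbrakk> \<Longrightarrow> integrable lborel w"
    and P_in_E: "\<lbrakk>0 \<le> h; h \<le> t; t \<le> T; w \<in> E h\<rbrakk> \<Longrightarrow> P t h w \<in> E t"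
    and P_start: "\<lbrakk>0 \<le> h; h \<le> T; w \<in> E h\<rbrakk> \<Longrightarrow> AE x in lborel. w x = P h h w x"
    and P_lipschitz:
      "\<lbrakk>0 \<le> h; h \<le> t1; t1 \<le> T; h \<le> t2; t2 \<le> T; w1 \<in> E h; w2 \<in> E h\<rbrakk> \<Longrightarrow>
         L1_dist (P t1 h w1) (P t2 h w2) \<le> L * (L1_dist w1 w2 + \<bar>t2 - t1\<bar>)"
    and P_semigroup:
      "\<lbrakk>0 \<le> t0; t0 \<le> t1; t1 \<le> t2; t2 \<le> T; w \<in> E t0\<rbrakk> \<Longrightarrow>
         AE x in lborel. P t2 t0 w x = P t2 t1 (P t1 t0 w) x"
begin

lemma P_integrable:
  "\<lbrakk>0 \<le> h; h \<le> t; t \<le> T; w \<in> E h\<rbrakk> \<Longrightarrow> integrable lborel (P t h w)"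
  using E_integrable[of t "P t h w"] P_in_E by force

text \<open>Restarting \<open>P\<close> from successive nodes changes the outcome at time \<open>t\<close> by the transported
  one-step error: \<open>P\<close> started at node \<open>k\<close> agrees with \<open>P\<close> started at time \<open>(k+1)\<tau>\<close> from the exact
  one-step evolution of node \<open>k\<close>, and that datum is \<open>e\<close>-close to node \<open>k+1\<close>.\<close>

lemma restart_error:
  assumes \<tau>: "0 < \<tau>"
    and in_E: "\<And>k. real k * \<tau> < T \<Longrightarrow> w k \<in> E (real k * \<tau>)"
    and step: "\<And>k. real (Suc k) * \<tau> \<le> T \<Longrightarrow>
                 L1_dist (w (Suc k)) (P (real (Suc k) * \<tau>) (real k * \<tau>) (w k)) \<le> e"
    and k: "real k * \<tau> < T" "real k * \<tau> \<le> t" "t \<le> T"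
  shows "L1_dist (P t (real k * \<tau>) (w k)) (P t 0 (w 0)) \<le> real k * (L * e)"
  using k
proof (induction k)
  case 0
  then show ?case by (simp add: L1_dist_def)
next
  case (Suc k)
  let ?a = "real k * \<tau>" and ?b = "real (Suc k) * \<tau>"
  have ab: "0 \<le> ?a" "?a \<le> ?b" "?a < T" "0 \<le> ?b"
    using \<tau> Suc.prems by (auto simp: algebra_simps)
  have wk: "w k \<in> E ?a" and wSk: "w (Suc k) \<in> E ?b" and w0: "w 0 \<in> E 0"
    using in_E[of k] in_E[of "Suc k"] in_E[of 0] ab Suc.prems by auto
  let ?v = "P ?b ?a (w k)"
  have v: "?v \<in> E ?b"
    using P_in_E ab Suc.prems wk by simp
  have i1: "integrable lborel (P t ?b (w (Suc k)))"
    and i2: "integrable lborel (P t ?b ?v)"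
    and i3: "integrable lborel (P t ?a (w k))"
    and i4: "integrable lborel (P t 0 (w 0))"
    using P_integrable ab Suc.prems wk wSk v w0 by auto
  have "L1_dist (P t ?b (w (Suc k))) (P t ?b ?v) \<le> L * (L1_dist (w (Suc k)) ?v + \<bar>t - t\<bar>)"
    using P_lipschitz ab Suc.prems wSk v by blast
  also have "\<dots> \<le> L * e"
    using step[of k] Suc.prems L_nonneg by (simp add: mult_left_mono)
  finally have 1: "L1_dist (P t ?b (w (Suc k))) (P t ?b ?v) \<le> L * e" .
  have "L1_dist (P t ?a (w k)) (P t ?b ?v) = 0"
    using P_semigroup[of ?a ?b t "w k"] ab Suc.prems wk by (intro L1_dist_eq_0_AE) simp
  then have 2: "L1_dist (P t ?b ?v) (P t ?a (w k)) = 0"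
    by (simp add: L1_dist_commute)
  have 3: "L1_dist (P t ?a (w k)) (P t 0 (w 0)) \<le> real k * (L * e)"
    using Suc.IH Suc.prems ab by simp
  have "L1_dist (P t ?b (w (Suc k))) (P t 0 (w 0)) \<le> L * e + 0 + real k * (L * e)"
    using L1_dist_triangle[OF i1 i2 i4] L1_dist_triangle[OF i2 i3 i4] 1 2 3 by linarith
  then show ?case
    by (simp add: algebra_simps)
qed

text \<open>The error accumulated over \<open>n\<close> steps. A node at the final time \<open>T\<close> need not be an admissible
  datum for \<open>P\<close>, so the error of the last step enters without being transported; this accounts
  for the constant \<open>L + 1\<close>.\<close>

lemma node_error:
  assumes \<tau>: "0 < \<tau>"
    and T: "0 < T"
    and in_E: "\<And>k. real k * \<tau> < T \<Longrightarrow> w k \<in> E (real k * \<tau>)"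
    and int: "integrable lborel (w n)"
    and step: "\<And>k. real (Suc k) * \<tau> \<le> T \<Longrightarrow>
                 L1_dist (w (Suc k)) (P (real (Suc k) * \<tau>) (real k * \<tau>) (w k)) \<le> e"
    and e: "0 \<le> e"
    and n: "real n * \<tau> \<le> T"
  shows "L1_dist (w n) (P (real n * \<tau>) 0 (w 0)) \<le> real n * ((L + 1) * e)"
proof (cases n)
  case 0
  then show ?thesis
    using L1_dist_eq_0_AE[OF P_start[of 0 "w 0"]] in_E[of 0] T by simp
next
  case (Suc k)
  let ?a = "real k * \<tau>" and ?b = "real n * \<tau>"
  have ab: "0 \<le> ?a" "?a \<le> ?b" "?a < T" "0 \<le> ?b"
    using \<tau> n Suc by (auto simp: algebra_simps)
  have wk: "w k \<in> E ?a" and w0: "w 0 \<in> E 0"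
    using in_E[of k] in_E[of 0] ab T by auto
  have "L1_dist (w n) (P ?b 0 (w 0))
      \<le> L1_dist (w n) (P ?b ?a (w k)) + L1_dist (P ?b ?a (w k)) (P ?b 0 (w 0))"
    using P_integrable ab n wk w0 int by (intro L1_dist_triangle) auto
  also have "L1_dist (w n) (P ?b ?a (w k)) \<le> e"
    using step[of k] n Suc by simp
  also have "L1_dist (P ?b ?a (w k)) (P ?b 0 (w 0)) \<le> real k * (L * e)"
    by (rule restart_error[OF \<tau> in_E step ab(3,2) n])
  also have "e + real k * (L * e) \<le> real n * ((L + 1) * e)"
    using e L_nonneg Suc by (simp add: algebra_simps)
  finally show ?thesis by simp
qed

text \<open>The error at an arbitrary time: the nearest node below \<open>t\<close> is reached after at most
  \<open>T / \<tau>\<close> steps, and the remaining time is less than \<open>\<tau>\<close>.\<close>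

lemma fs_approx_error:
  assumes \<tau>: "0 < \<tau>"
    and T: "0 < T"
    and in_E: "\<And>k. real k * \<tau> < T \<Longrightarrow> fs_node F g \<epsilon> \<tau> w k \<in> E (real k * \<tau>)"
    and int: "\<And>t. t \<in> {0..T} \<Longrightarrow> integrable lborel (fs_approx F g \<epsilon> \<tau> w t)"
    and step: "\<And>k. real (Suc k) * \<tau> \<le> T \<Longrightarrow>
                 L1_dist (fs_node F g \<epsilon> \<tau> w (Suc k))
                   (P (real (Suc k) * \<tau>) (real k * \<tau>) (fs_node F g \<epsilon> \<tau> w k)) \<le> \<tau> * e"
    and e: "0 \<le> e"
    and F_lipschitz: "\<And>k s. \<lbrakk>real k * \<tau> < T; 0 \<le> s\<rbrakk> \<Longrightarrow>
      L1_dist (F (real k * \<tau> + s) (real k * \<tau>) (fs_node F g \<epsilon> \<tau> w k))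
        (fs_node F g \<epsilon> \<tau> w k) \<le> L' * s"
    and L': "0 \<le> L'"
    and t: "t \<in> {0..T}"
  shows "L1_dist (fs_approx F g \<epsilon> \<tau> w t) (P t 0 w) \<le> (L + 1) * T * e + (L + L') * \<tau>"
proof -
  let ?z = "fs_node F g \<epsilon> \<tau> w"
  define n where "n = nat \<lfloor>t / \<tau>\<rfloor>"
  let ?a = "real n * \<tau>"
  have rn: "real n = of_int \<lfloor>t / \<tau>\<rfloor>"
    using t \<tau> by (simp add: n_def)
  have "real n \<le> t / \<tau>" "t / \<tau> < real n + 1"
    unfolding rn by linarith+
  then have n1: "?a \<le> t" and n2: "t < ?a + \<tau>"
    using \<tau> by (simp_all add: field_simps)
  have a0: "0 \<le> ?a" using \<tau> by simp
  have aT: "?a \<le> T" using n1 t by simp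
  have node: "fs_approx F g \<epsilon> \<tau> w ?a = ?z n"
    using \<tau> by (simp add: fs_approx_def Let_def)
  have zn: "integrable lborel (?z n)"
    using int[of ?a] node a0 aT by simp
  have w0: "w \<in> E 0"
    using in_E[of 0] T by simp
  have Pa: "integrable lborel (P ?a 0 w)" and Pt: "integrable lborel (P t 0 w)"
    using P_integrable w0 a0 aT t by auto
  have "L1_dist (?z n) (P ?a 0 (?z 0)) \<le> real n * ((L + 1) * (\<tau> * e))"
    by (rule node_error[OF \<tau> T in_E zn step _ aT]) (use \<tau> e in auto)
  also have "\<dots> = ?a * ((L + 1) * e)"
    by (simp add: algebra_simps)
  also have "\<dots> \<le> T * ((L + 1) * e)"
    using aT e L_nonneg by (intro mult_right_mono) auto
  finally have 1: "L1_dist (?z n) (P ?a 0 w) \<le> (L + 1) * T * e"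
    by (simp add: algebra_simps)
  have "L1_dist (P ?a 0 w) (P t 0 w) \<le> L * (L1_dist w w + \<bar>t - ?a\<bar>)"
    using P_lipschitz[of 0 ?a t w w] a0 aT t w0 by simp
  also have "\<dots> \<le> L * \<tau>"
    using n1 n2 L_nonneg by (intro mult_left_mono) (auto simp: L1_dist_def)
  finally have 2: "L1_dist (P ?a 0 w) (P t 0 w) \<le> L * \<tau>" .
  have 3: "L1_dist (fs_approx F g \<epsilon> \<tau> w t) (?z n) \<le> L' * \<tau>"
  proof (cases "t = ?a")
    case True
    then show ?thesis
      using node L' \<tau> by (simp add: L1_dist_def)
  next
    case False
    then have "fs_approx F g \<epsilon> \<tau> w t = F (?a + (t - ?a)) ?a (?z n)"
      by (simp add: fs_approx_def Let_def n_def)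
    then have "L1_dist (fs_approx F g \<epsilon> \<tau> w t) (?z n) \<le> L' * (t - ?a)"
      using F_lipschitz[of n "t - ?a"] False n1 t by simp
    also have "\<dots> \<le> L' * \<tau>"
      using n2 L' by (intro mult_left_mono) auto
    finally show ?thesis .
  qed
  show ?thesis
    using L1_dist_triangle[OF int[OF t] zn Pt] L1_dist_triangle[OF zn Pa Pt] 1 2 3
    by (simp add: distrib_right)
qed

end

text \<open>That \<open>P\<close> starts from its datum is a consequence of its definition: all viscous
  approximations take the value \<open>w\<close> at the initial time, hence so does their limit.\<close>

lemma viscous_solution_operator_lipschitz_evolution:
  assumes "viscous_solution_operator \<Omega> A g T E P"
  obtains L where "lipschitz_evolution T E P L"
proof -
  note op = assms[unfolded viscous_solution_operator_def]
  obtain L where L: "L > 0"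
    "\<forall>h\<in>{0..T}. \<forall>t1\<in>{h..T}. \<forall>t2\<in>{h..T}. \<forall>w1\<in>E h. \<forall>w2\<in>E h.
        L1_dist (P t1 h w1) (P t2 h w2) \<le> L * (L1_dist w1 w2 + \<bar>t2 - t1\<bar>)"
    using op by blast
  have start: "AE x in lborel. w x = P h h w x" if "0 \<le> h" "h \<le> T" "w \<in> E h" for h w
  proof -
    have "vanishing_viscosity_solution \<Omega> A g h {h..T} w (\<lambda>t. P t h w)"
      using op that by auto
    then obtain U where U: "\<forall>\<^sub>F \<epsilon> in at_right 0. viscous_solution \<Omega> A g \<epsilon> h {h..T} w (U \<epsilon>)"
      and lim: "\<forall>t\<in>{h..T}. L1loc_tendsto (\<lambda>\<epsilon>. U \<epsilon> t) (P t h w) (at_right 0)"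
      unfolding vanishing_viscosity_solution_def by blast
    have "\<forall>\<^sub>F \<epsilon> in at_right 0. U \<epsilon> h = w"
      using U by eventually_elim (simp add: viscous_solution_def)
    moreover have "L1loc_tendsto (\<lambda>\<epsilon>. U \<epsilon> h) (P h h w) (at_right 0)"
      using lim that by auto
    ultimately show ?thesis
      by (intro L1loc_tendsto_const_AE_eq) auto
  qed
  have "lipschitz_evolution T E P L"
  proof
    show "0 \<le> L" using L(1) by simp
    show "integrable lborel w" if "0 \<le> h" "h \<le> T" "w \<in> E h" for h w
      using op that by auto
    show "P t h w \<in> E t" if "0 \<le> h" "h \<le> t" "t \<le> T" "w \<in> E h" for h t w
      using op that by auto
    show "L1_dist (P t1 h w1) (P t2 h w2) \<le> L * (L1_dist w1 w2 + \<bar>t2 - t1\<bar>)"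
      if "0 \<le> h" "h \<le> t1" "t1 \<le> T" "h \<le> t2" "t2 \<le> T" "w1 \<in> E h" "w2 \<in> E h" for h t1 t2 w1 w2
      using L(2) that by auto
    show "AE x in lborel. P t2 t0 w x = P t2 t1 (P t1 t0 w) x"
      if "0 \<le> t0" "t0 \<le> t1" "t1 \<le> t2" "t2 \<le> T" "w \<in> E t0" for t0 t1 t2 w
      using op that by blast
  qed (fact start)
  then show ?thesis by (rule that)
qed

section \<open>Choosing the approximations of the datum\<close>

text \<open>If each \<open>Q k\<close> holds eventually, an index can run to infinity slowly enough to keep \<open>Q\<close> true
  along the way: take the largest admissible \<open>k \<le> \<nu>\<close>.\<close>

lemma slow_diagonal:
  fixes Q :: "nat \<Rightarrow> nat \<Rightarrow> bool"
  assumes "\<And>k. eventually (Q k) sequentially"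
  obtains m :: "nat \<Rightarrow> nat"
  where "filterlim m at_top sequentially" "\<forall>\<^sub>F \<nu> in sequentially. Q (m \<nu>) \<nu>"
proof -
  \<comment> \<open>The element \<open>0\<close> only keeps the set nonempty; eventually the maximum is positive, hence
    admissible.\<close>
  define M where "M \<nu> = insert 0 {k. k \<le> \<nu> \<and> Q k \<nu>}" for \<nu>
  define m where "m \<nu> = Max (M \<nu>)" for \<nu>
  have fin: "finite (M \<nu>)" for \<nu>
    by (simp add: M_def)
  have ge: "\<forall>\<^sub>F \<nu> in sequentially. k \<le> m \<nu>" for k
    using assms[of k] eventually_ge_at_top[of k]
  proof eventually_elim
    case (elim \<nu>)
    then have "k \<in> M \<nu>" by (simp add: M_def)
    then show ?case unfolding m_def using fin by (rule Max_ge[rotated])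
  qed
  then have "filterlim m at_top sequentially"
    by (simp add: filterlim_at_top)
  moreover have "\<forall>\<^sub>F \<nu> in sequentially. Q (m \<nu>) \<nu>"
    using ge[of 1]
  proof eventually_elim
    case (elim \<nu>)
    have "m \<nu> \<in> M \<nu>"
      unfolding m_def using fin by (rule Max_in) (simp add: M_def)
    with elim show ?case by (auto simp: M_def)
  qed
  ultimately show ?thesis by (rule that)
qed

lemma Dp_subset_Dom: "Dp H \<delta> \<subseteq> Dom H \<delta>"
proof
  fix w assume w: "w \<in> Dp H \<delta>"
  have "L1_dist w w = 0" by (simp add: L1_dist_def)
  with w show "w \<in> Dom H \<delta>"
    unfolding Dom_def by (auto simp: Dp_def intro!: bexI[of _ w])
qed

section \<open>Convergence of the fractional step scheme\<close>

theorem theorem14: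
  fixes H :: "('n::finite) hyp_sys"
    and g :: "real \<Rightarrow> real \<Rightarrow> real^'n \<Rightarrow> real^'n"
    and S P :: "real \<Rightarrow> real \<Rightarrow> (real \<Rightarrow> real^'n) \<Rightarrow> real \<Rightarrow> real^'n"
    and SFT :: "nat \<Rightarrow> real \<Rightarrow> real \<Rightarrow> (real \<Rightarrow> real^'n) \<Rightarrow> real \<Rightarrow> real^'n"
    and E :: "real \<Rightarrow> (real \<Rightarrow> real^'n) set"
    and \<epsilon> \<tau> :: "nat \<Rightarrow> real"
    and \<delta>H \<delta> T G :: real
    and small_o :: "real \<Rightarrow> real"
  assumes hyperbolic: "strictly_hyperbolic H"
    and elementary: "elementary_data H"
    and C1_pos: "0 < C1 H"
    and source: "source_assumption (Om H) g"
    and steps: "decseq \<epsilon>" "\<epsilon> \<longlonglongrightarrow> 0" "\<And>\<nu>. 0 < \<tau> \<nu> \<and> \<tau> \<nu> \<le> \<epsilon> \<nu>"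
    and deltas: "0 < \<delta>" "\<delta> < \<delta>H"
    and T_pos: "0 < T"
    and homogeneous: "homogeneous_operator H \<delta>H S"
    and algorithm: "front_tracking_algorithm H \<delta>H \<epsilon> S SFT"
    and viscous: "viscous_solution_operator (Om H) (Amat H) g T E P"
    and i_small_o: "((\<lambda>s. small_o s / s) \<longlongrightarrow> 0) (at_right 0)"
    and i_constructible:
      "\<And>w \<nu>. w \<in> Dp H \<delta> \<Longrightarrow> fs_constructible H \<delta>H E (SFT \<nu>) g (\<epsilon> \<nu>) (\<tau> \<nu>) T w"
    and i_bound:
      "\<And>w \<nu> t. w \<in> Dp H \<delta> \<Longrightarrow> t \<in> {0..T} \<Longrightarrow>
         fs_approx (SFT \<nu>) g (\<epsilon> \<nu>) (\<tau> \<nu>) w t \<in> Dp H (\<delta> + G * t)"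
    and i_local_error:
      "\<And>w. w \<in> Dp H \<delta> \<Longrightarrow>
         \<exists>K. \<forall>\<nu> n. 1 \<le> n \<and> real n * \<tau> \<nu> \<le> T \<longrightarrow>
           L1_dist (fs_node (SFT \<nu>) g (\<epsilon> \<nu>) (\<tau> \<nu>) w n)
             (P (real n * \<tau> \<nu>) (real (n - 1) * \<tau> \<nu>)
                (fs_node (SFT \<nu>) g (\<epsilon> \<nu>) (\<tau> \<nu>) w (n - 1)))
           \<le> K * (small_o (\<tau> \<nu>) + \<epsilon> \<nu> * \<tau> \<nu>)"
    and ii: "Dom H \<delta> \<subseteq> E 0"
  shows "\<forall>u\<in>Dom H \<delta>. \<exists>wbar :: nat \<Rightarrow> real \<Rightarrow> real^'n.
           (\<forall>\<nu>. wbar \<nu> \<in> Dp H \<delta>) \<and>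
           L1_tendsto wbar u sequentially \<and>
           (AE t in lborel. t \<in> {0..T} \<longrightarrow>
              L1_tendsto (\<lambda>\<nu>. fs_approx (SFT \<nu>) g (\<epsilon> \<nu>) (\<tau> \<nu>) (wbar \<nu>) t) (P t 0 u) sequentially)"
proof
  fix u assume u: "u \<in> Dom H \<delta>"
  obtain L where "lipschitz_evolution T E P L"
    using viscous_solution_operator_lipschitz_evolution[OF viscous] .
  then interpret lipschitz_evolution T E P L .
  obtain L0 where L0: "\<And>\<nu> t s w. \<lbrakk>0 \<le> t; 0 \<le> s; w \<in> Dp H \<delta>H\<rbrakk> \<Longrightarrow>
      L1_dist (SFT \<nu> (t + s) t w) w \<le> L0 * s"
    using algorithm[unfolded front_tracking_algorithm_def, THEN conjunct2, THEN conjunct1] by meson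
  define L' where "L' = \<bar>L0\<bar>"
  have \<tau>_pos: "0 < \<tau> \<nu>" and \<tau>_le: "\<tau> \<nu> \<le> \<epsilon> \<nu>" and \<epsilon>_pos: "0 < \<epsilon> \<nu>" for \<nu>
    using steps(3)[of \<nu>] by auto
  have uE: "u \<in> E 0" using u ii by blast

  have "\<exists>w\<in>Dp H \<delta>. L1_dist w u < inverse (real (Suc k))" for k
    using u by (auto simp: Dom_def)
  then obtain z where z: "\<And>k. z k \<in> Dp H \<delta>"
    and z_u: "\<And>k. L1_dist (z k) u < inverse (real (Suc k))"
    by metis
  have "\<exists>K. \<forall>k. \<forall>\<nu> n. 1 \<le> n \<and> real n * \<tau> \<nu> \<le> T \<longrightarrow>
      L1_dist (fs_node (SFT \<nu>) g (\<epsilon> \<nu>) (\<tau> \<nu>) (z k) n)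
        (P (real n * \<tau> \<nu>) (real (n - 1) * \<tau> \<nu>) (fs_node (SFT \<nu>) g (\<epsilon> \<nu>) (\<tau> \<nu>) (z k) (n - 1)))
      \<le> K k * (small_o (\<tau> \<nu>) + \<epsilon> \<nu> * \<tau> \<nu>)"
    by (rule choice, rule allI, rule i_local_error[OF z])
  then obtain K where K: "\<forall>k. \<forall>\<nu> n. 1 \<le> n \<and> real n * \<tau> \<nu> \<le> T \<longrightarrow>
      L1_dist (fs_node (SFT \<nu>) g (\<epsilon> \<nu>) (\<tau> \<nu>) (z k) n)
        (P (real n * \<tau> \<nu>) (real (n - 1) * \<tau> \<nu>) (fs_node (SFT \<nu>) g (\<epsilon> \<nu>) (\<tau> \<nu>) (z k) (n - 1)))
      \<le> K k * (small_o (\<tau> \<nu>) + \<epsilon> \<nu> * \<tau> \<nu>)" ..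

  \<comment> \<open>The one-step error per unit of time, up to the constant depending on the datum.\<close>
  define \<eta> where "\<eta> \<nu> = \<bar>small_o (\<tau> \<nu>) / \<tau> \<nu>\<bar> + \<epsilon> \<nu>" for \<nu>
  have \<eta>_nonneg: "0 \<le> \<eta> \<nu>" for \<nu>
    using \<epsilon>_pos[of \<nu>] by (simp add: \<eta>_def)
  have \<tau>_lim: "\<tau> \<longlonglongrightarrow> 0"
    by (rule tendsto_sandwich[OF _ _ tendsto_const steps(2)])
       (auto intro!: always_eventually less_imp_le[OF \<tau>_pos] \<tau>_le)
  then have "filterlim \<tau> (at_right 0) sequentially"
    by (auto simp: filterlim_at \<tau>_pos less_imp_neq[OF \<tau>_pos, symmetric])
  then have "(\<lambda>\<nu>. small_o (\<tau> \<nu>) / \<tau> \<nu>) \<longlonglongrightarrow> 0"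
    by (rule filterlim_compose[OF i_small_o])
  then have \<eta>_lim: "\<eta> \<longlonglongrightarrow> 0"
    unfolding \<eta>_def using tendsto_add[OF tendsto_rabs_zero steps(2)] by fastforce

  have scheme_error:
    "L1_dist (fs_approx (SFT \<nu>) g (\<epsilon> \<nu>) (\<tau> \<nu>) (z k) t) (P t 0 (z k))
      \<le> (L + 1) * T * (\<bar>K k\<bar> * \<eta> \<nu>) + (L + L') * \<tau> \<nu>"
    if t: "t \<in> {0..T}" for k \<nu> t
  proof (rule fs_approx_error[OF \<tau>_pos T_pos _ _ _ _ _ _ t])
    let ?z = "fs_node (SFT \<nu>) g (\<epsilon> \<nu>) (\<tau> \<nu>) (z k)"
    have cons: "?z n \<in> Dp H \<delta>H" "?z n \<in> E (real n * \<tau> \<nu>)" if "real n * \<tau> \<nu> < T" for n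
      using i_constructible[OF z, of \<nu> k] that unfolding fs_constructible_def by auto
    show "?z n \<in> E (real n * \<tau> \<nu>)" if "real n * \<tau> \<nu> < T" for n
      using cons that by blast
    show "integrable lborel (fs_approx (SFT \<nu>) g (\<epsilon> \<nu>) (\<tau> \<nu>) (z k) t)" if "t \<in> {0..T}" for t
      using i_bound[OF z that] by (simp add: Dp_def)
    show "L1_dist (?z (Suc n)) (P (real (Suc n) * \<tau> \<nu>) (real n * \<tau> \<nu>) (?z n)) \<le> \<tau> \<nu> * (\<bar>K k\<bar> * \<eta> \<nu>)"
      if "real (Suc n) * \<tau> \<nu> \<le> T" for n
    proof -
      have "L1_dist (?z (Suc n)) (P (real (Suc n) * \<tau> \<nu>) (real n * \<tau> \<nu>) (?z n))
          \<le> K k * (small_o (\<tau> \<nu>) + \<epsilon> \<nu> * \<tau> \<nu>)"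
        using K[rule_format, of "Suc n" \<nu> k] that by simp
      also have "\<dots> \<le> \<bar>K k\<bar> * \<bar>small_o (\<tau> \<nu>) + \<epsilon> \<nu> * \<tau> \<nu>\<bar>"
        by (simp flip: abs_mult)
      also have "\<dots> \<le> \<bar>K k\<bar> * (\<bar>small_o (\<tau> \<nu>)\<bar> + \<epsilon> \<nu> * \<tau> \<nu>)"
        using \<tau>_pos[of \<nu>] \<epsilon>_pos[of \<nu>]
        by (intro mult_left_mono order_trans[OF abs_triangle_ineq]) (auto simp: abs_mult)
      also have "\<dots> = \<tau> \<nu> * (\<bar>K k\<bar> * \<eta> \<nu>)"
        using \<tau>_pos[of \<nu>] by (simp add: \<eta>_def field_simps)
      finally show ?thesis .
    qed
    show "0 \<le> \<bar>K k\<bar> * \<eta> \<nu>" using \<eta>_nonneg by simp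
    show "L1_dist (SFT \<nu> (real n * \<tau> \<nu> + s) (real n * \<tau> \<nu>) (?z n)) (?z n) \<le> L' * s"
      if "real n * \<tau> \<nu> < T" "0 \<le> s" for n s
    proof -
      have "L1_dist (SFT \<nu> (real n * \<tau> \<nu> + s) (real n * \<tau> \<nu>) (?z n)) (?z n) \<le> L0 * s"
        using L0[of "real n * \<tau> \<nu>" s "?z n" \<nu>] cons that \<tau>_pos[of \<nu>] by simp
      also have "\<dots> \<le> L' * s"
        unfolding L'_def using that by (intro mult_right_mono) auto
      finally show ?thesis .
    qed
    show "0 \<le> L'" by (simp add: L'_def)
  qed

  \<comment> \<open>The data are refined slowly enough for \<open>\<eta>\<close> to absorb the constants \<open>K\<close>.\<close>
  have "\<forall>\<^sub>F \<nu> in sequentially. \<bar>K k\<bar> * \<eta> \<nu> < inverse (real (Suc k))" for k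
  proof -
    have "(\<lambda>\<nu>. \<bar>K k\<bar> * \<eta> \<nu>) \<longlonglongrightarrow> 0"
      using tendsto_mult_right_zero[OF \<eta>_lim] .
    then show ?thesis by (rule order_tendstoD) simp
  qed
  then obtain m where m: "filterlim m at_top sequentially"
    and K\<eta>: "\<forall>\<^sub>F \<nu> in sequentially. \<bar>K (m \<nu>)\<bar> * \<eta> \<nu> < inverse (real (Suc (m \<nu>)))"
    by (rule slow_diagonal)
  have inv_lim: "(\<lambda>\<nu>. inverse (real (Suc (m \<nu>)))) \<longlonglongrightarrow> 0"
    by (rule filterlim_compose[OF LIMSEQ_inverse_real_of_nat m])
  have K\<eta>_lim: "(\<lambda>\<nu>. \<bar>K (m \<nu>)\<bar> * \<eta> \<nu>) \<longlonglongrightarrow> 0"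
    by (rule tendsto_sandwich[OF _ _ tendsto_const inv_lim])
       (use K\<eta> \<eta>_nonneg in \<open>auto elim: eventually_mono\<close>)
  define wbar where "wbar \<nu> = z (m \<nu>)" for \<nu>
  have wbar: "wbar \<nu> \<in> Dp H \<delta>" for \<nu>
    by (simp add: wbar_def z)
  have wbar_E: "wbar \<nu> \<in> E 0" for \<nu>
    using wbar Dp_subset_Dom ii by blast
  have wbar_lim: "(\<lambda>\<nu>. L1_dist (wbar \<nu>) u) \<longlonglongrightarrow> 0"
    by (rule tendsto_sandwich[OF _ _ tendsto_const inv_lim])
       (auto intro!: always_eventually less_imp_le[OF z_u]
         simp: wbar_def L1_dist_nonneg simp del: of_nat_Suc)

  have "L1_tendsto (\<lambda>\<nu>. fs_approx (SFT \<nu>) g (\<epsilon> \<nu>) (\<tau> \<nu>) (wbar \<nu>) t) (P t 0 u) sequentially"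
    if t: "t \<in> {0..T}" for t
  proof -
    let ?w = "\<lambda>\<nu>. fs_approx (SFT \<nu>) g (\<epsilon> \<nu>) (\<tau> \<nu>) (wbar \<nu>) t"
    have int_w: "integrable lborel (?w \<nu>)" for \<nu>
      using i_bound[OF wbar t] by (simp add: Dp_def)
    have int_P: "integrable lborel (P t 0 v)" if "v \<in> E 0" for v
      using P_integrable that t by simp
    let ?err = "\<lambda>\<nu>. (L + 1) * T * (\<bar>K (m \<nu>)\<bar> * \<eta> \<nu>) + (L + L') * \<tau> \<nu> + L * L1_dist (wbar \<nu>) u"
    have le: "L1_dist (?w \<nu>) (P t 0 u) \<le> ?err \<nu>" for \<nu>
    proof -
      have "L1_dist (?w \<nu>) (P t 0 u)
          \<le> L1_dist (?w \<nu>) (P t 0 (wbar \<nu>)) + L1_dist (P t 0 (wbar \<nu>)) (P t 0 u)"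
        by (intro L1_dist_triangle int_w int_P wbar_E uE)
      also have "L1_dist (?w \<nu>) (P t 0 (wbar \<nu>))
          \<le> (L + 1) * T * (\<bar>K (m \<nu>)\<bar> * \<eta> \<nu>) + (L + L') * \<tau> \<nu>"
        unfolding wbar_def by (rule scheme_error[OF t])
      also have "L1_dist (P t 0 (wbar \<nu>)) (P t 0 u) \<le> L * L1_dist (wbar \<nu>) u"
        using P_lipschitz[of 0 t t "wbar \<nu>" u] t wbar_E uE by simp
      finally show ?thesis by simp
    qed
    have lim: "?err \<longlonglongrightarrow> 0"
      by (intro tendsto_add_zero tendsto_mult_right_zero K\<eta>_lim \<tau>_lim wbar_lim)
    have "(\<lambda>\<nu>. L1_dist (?w \<nu>) (P t 0 u)) \<longlonglongrightarrow> 0"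
      by (rule tendsto_sandwich[OF always_eventually always_eventually tendsto_const lim])
         (rule allI, rule L1_dist_nonneg, rule allI, rule le)
    then show ?thesis
      unfolding L1_tendsto_def using int_w int_P[OF uE] by simp
  qed
  moreover have "L1_tendsto wbar u sequentially"
  proof -
    have "integrable lborel (wbar \<nu>)" for \<nu>
      using wbar by (simp add: Dp_def)
    moreover have "integrable lborel u"
      using u by (simp add: Dom_def)
    ultimately show ?thesis
      unfolding L1_tendsto_def using wbar_lim by simp
  qed
  ultimately show "\<exists>wbar :: nat \<Rightarrow> real \<Rightarrow> real^'n.
           (\<forall>\<nu>. wbar \<nu> \<in> Dp H \<delta>) \<and>
           L1_tendsto wbar u sequentially \<and>
           (AE t in lborel. t \<in> {0..T} \<longrightarrow>
              L1_tendsto (\<lambda>\<nu>. fs_approx (SFT \<nu>) g (\<epsilon> \<nu>) (\<tau> \<nu>) (wbar \<nu>) t) (P t 0 u) sequentially)"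
    using wbar by (intro exI[of _ wbar] conjI allI AE_I2 impI) simp_all
qed

end
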